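(* The principle $\mathrm{HT}^{=2}_2$ is not computably true. That is, there is a computable function $c:\mathbb N\to\{0,1\}$ such that there is no computable infinite set $H\subseteq\mathbb N$ for which all sums $x+y$ with $x,y\in H$, $x\neq y$, have the same color under $c$.
   Context: $\mathrm{HT}^{=2}_2$ is the statement: for every $c:\mathbb N\to\{0,1\}$ (an instance) there is an infinite set $H\subseteq\mathbb N$ (a solution to $c$) such that $c(x+y)$ takes the same value for all $x,y\in H$ with $x\neq y$. A principle of this form is computably true if every computable instance has a computable solution. *)

theory Defs
  imports Main
begin

section \<open>Partial recursive functions\<close>

text \<open>
  Programs for Kleene's partial recursive functions, with functional graph
  \<open>rec_eval r xs y\<close>: the function given by \<open>r\<close> is defined at the argument tuple \<open>xs\<close>
  and has value \<open>y\<close> there. Arities are not tracked by the syntax: a program is simply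
  undefined on tuples of an unsuitable length. \<open>Zero\<close> is the zero function of every arity.
\<close>

datatype recf =
    Zero
  | Succ
  | Proj nat
  | Comp recf "recf list"
  | Prec recf recf
  | Mu recf

text \<open>
  In \<open>Prec\<close> the recursion argument comes first, followed in the step function by the previous
  value. In \<open>Mu\<close> the searched argument comes first, and the search diverges if the body is
  undefined at some argument before the first zero.
\<close>

inductive rec_eval :: "recf \<Rightarrow> nat list \<Rightarrow> nat \<Rightarrow> bool" where
  Zero: "rec_eval Zero xs 0"
| Succ: "rec_eval Succ [x] (Suc x)"
| Proj: "i < length xs \<Longrightarrow> rec_eval (Proj i) xs (xs ! i)"
| Comp: "list_all2 (\<lambda>g y. rec_eval g xs y) gs ys \<Longrightarrow> rec_eval f ys z \<Longrightarrow>
    rec_eval (Comp f gs) xs z"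
| Prec_0: "rec_eval f xs y \<Longrightarrow> rec_eval (Prec f g) (0 # xs) y"
| Prec_Suc: "rec_eval (Prec f g) (n # xs) y \<Longrightarrow> rec_eval g (n # y # xs) z \<Longrightarrow>
    rec_eval (Prec f g) (Suc n # xs) z"
| Mu: "rec_eval f (n # xs) 0 \<Longrightarrow> (\<And>m. m < n \<Longrightarrow> \<exists>y. rec_eval f (m # xs) (Suc y)) \<Longrightarrow>
    rec_eval (Mu f) xs n"

inductive_cases rec_eval_ZeroE: "rec_eval Zero xs y"
inductive_cases rec_eval_SuccE: "rec_eval Succ xs y"
inductive_cases rec_eval_ProjE: "rec_eval (Proj i) xs y"
inductive_cases rec_eval_CompE: "rec_eval (Comp f gs) xs y"
inductive_cases rec_eval_Prec_0E: "rec_eval (Prec f g) (0 # xs) y"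
inductive_cases rec_eval_Prec_SucE: "rec_eval (Prec f g) (Suc n # xs) y"
inductive_cases rec_eval_MuE: "rec_eval (Mu f) xs y"

lemma rec_eval_deterministic:
  "rec_eval r xs y \<Longrightarrow> rec_eval r xs z \<Longrightarrow> y = z"
proof (induction r xs y arbitrary: z rule: rec_eval.induct)
  case (Zero xs)
  then show ?case by (auto elim: rec_eval_ZeroE)
next
  case (Succ x)
  then show ?case by (auto elim: rec_eval_SuccE)
next
  case (Proj i xs)
  from Proj.prems show ?case by (auto elim: rec_eval_ProjE)
next
  case (Comp xs gs ys f y)
  from Comp.prems obtain ys' where
    ys': "list_all2 (\<lambda>g y. rec_eval g xs y) gs ys'" "rec_eval f ys' z"
    by (rule rec_eval_CompE)
  note len = list_all2_lengthD[OF Comp.IH(1)] list_all2_lengthD[OF ys'(1)]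
  have "ys = ys'"
  proof (rule nth_equalityI)
    show "length ys = length ys'" using len by (simp only:)
    show "ys ! i = ys' ! i" if "i < length ys" for i
    proof -
      have i: "i < length gs" using that len(1) by (simp only:)
      from list_all2_nthD[OF Comp.IH(1) i]
      have "\<forall>z. rec_eval (gs ! i) xs z \<longrightarrow> ys ! i = z" by (rule conjunct2)
      then have "rec_eval (gs ! i) xs (ys' ! i) \<longrightarrow> ys ! i = ys' ! i" by (rule spec)
      then show ?thesis using list_all2_nthD[OF ys'(1) i] by (rule mp)
    qed
  qed
  with ys'(2) have "rec_eval f ys z" by simp
  then show ?case by (rule Comp.IH(2))
next
  case (Prec_0 f xs y g)
  from Prec_0.prems have "rec_eval f xs z" by (rule rec_eval_Prec_0E)
  then show ?case by (rule Prec_0.IH)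
next
  case (Prec_Suc f g n xs y w)
  from Prec_Suc.prems obtain y' where
    y': "rec_eval (Prec f g) (n # xs) y'" "rec_eval g (n # y' # xs) z"
    by (rule rec_eval_Prec_SucE)
  from y'(2) have "rec_eval g (n # y # xs) z"
    by (simp only: Prec_Suc.IH(1)[OF y'(1)])
  then show ?case by (rule Prec_Suc.IH(2))
next
  case (Mu f n xs)
  from Mu.prems have z0: "rec_eval f (z # xs) 0" and
    zpos: "\<forall>m<z. \<exists>y. rec_eval f (m # xs) (Suc y)"
    by (auto elim: rec_eval_MuE)
  show ?case
  proof (cases n z rule: linorder_cases)
    case less
    then obtain y where "rec_eval f (n # xs) (Suc y)" using zpos by blast
    from Mu.IH(1)[OF this] show ?thesis by simp
  next
    case greater
    from Mu.IH(2)[OF this] obtain y where "\<forall>w. rec_eval f (z # xs) w \<longrightarrow> Suc y = w"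
      by (elim exE conjE)
    with z0 have "Suc y = 0" by (elim allE impE)
    then show ?thesis by simp
  qed
qed

definition computable :: "(nat \<Rightarrow> nat) \<Rightarrow> bool" where
  "computable f \<longleftrightarrow> (\<exists>r. \<forall>x. rec_eval r [x] (f x))"

definition computable_set :: "nat set \<Rightarrow> bool" where
  "computable_set A \<longleftrightarrow> computable (\<lambda>x. if x \<in> A then 1 else 0)"

section \<open>Principles and their computable truth\<close>

text \<open>
  A principle is given by its instances, here functions on the naturals, and by the relation
  saying which sets are solutions of an instance.
\<close>

definition computably_true ::
  "((nat \<Rightarrow> nat) \<Rightarrow> bool) \<Rightarrow> ((nat \<Rightarrow> nat) \<Rightarrow> nat set \<Rightarrow> bool) \<Rightarrow> bool" where
  "computably_true inst sol \<longleftrightarrow>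
    (\<forall>c. inst c \<and> computable c \<longrightarrow> (\<exists>H. sol c H \<and> computable_set H))"

text \<open>
  Hindman's theorem for sums of exactly two distinct elements and two colours. Here \<open>0\<close> counts
  as a natural number; this is immaterial, since \<open>0\<close> may be removed from any solution.
\<close>

definition HT_eq2_2_instance :: "(nat \<Rightarrow> nat) \<Rightarrow> bool" where
  "HT_eq2_2_instance c \<longleftrightarrow> (\<forall>x. c x \<in> {0, 1})"

definition HT_eq2_2_solution :: "(nat \<Rightarrow> nat) \<Rightarrow> nat set \<Rightarrow> bool" where
  "HT_eq2_2_solution c H \<longleftrightarrow>
    infinite H \<and> (\<exists>k. \<forall>x\<in>H. \<forall>y\<in>H. x \<noteq> y \<longrightarrow> c (x + y) = k)"

lemma not_computably_true_HT_eq2_2_iff: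
  "\<not> computably_true HT_eq2_2_instance HT_eq2_2_solution \<longleftrightarrow>
    (\<exists>c. (\<forall>x. c x \<in> {0, 1}) \<and> computable c \<and>
      \<not> (\<exists>H. computable_set H \<and> infinite H \<and>
            (\<exists>k. \<forall>x\<in>H. \<forall>y\<in>H. x \<noteq> y \<longrightarrow> c (x + y) = k)))"
  unfolding computably_true_def HT_eq2_2_instance_def HT_eq2_2_solution_def
  by (simp only: not_all not_imp conj_assoc) (simp only: conj_ac)

end

(*
  Colour x by the half circle that contains the phase of x, where the phase at x is the sum of
  rational slopes alpha_y over y < x, taken modulo 1. Suppose that all slopes from some point on
  lie in an interval I such that, for three elements a < b < c of H, every alpha in I has
  alpha * (b - a) in [1/4, 1/2] and alpha * (c - a) in [1/2, 3/4] modulo 1. Averages of slopes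
  stay in I, so for every large s the phases of s + a, s + b, s + c do not fit into one half
  circle, and H is not a solution. If b - a and then c - a are large enough, such an I exists
  inside any prescribed interval; so the requirements for the candidate sets, in order of
  priority, yield nested intervals. At stage t each requirement uses the first suitable triple
  found by then, and for each requirement the choice is eventually constant. An infinite
  computable H always provides a triple, because its elements are unbounded and its eventual
  interval of higher priority is fixed.
*)

theory Submission
  imports Defs Complex_Main "HOL-Library.Nat_Bijection" "HOL-Library.Infinite_Set"
begin

section \<open>Computable functions\<close>

text \<open>\<open>Prec\<close> and \<open>Mu\<close> programs act on tuples, so unary functions
  alone do not get recursion started. Two and three arguments suffice until pairing is
  available.\<close>

definition computable2 :: "(nat \<Rightarrow> nat \<Rightarrow> nat) \<Rightarrow> bool" where
  "computable2 h \<longleftrightarrow> (\<exists>r. \<forall>x y. rec_eval r [x, y] (h x y))"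

definition computable3 :: "(nat \<Rightarrow> nat \<Rightarrow> nat \<Rightarrow> nat) \<Rightarrow> bool" where
  "computable3 h \<longleftrightarrow> (\<exists>r. \<forall>x y z. rec_eval r [x, y, z] (h x y z))"

named_theorems computable_intros

lemma rec_eval_Comp1:
  "rec_eval g xs y \<Longrightarrow> rec_eval f [y] z \<Longrightarrow> rec_eval (Comp f [g]) xs z"
  by (rule rec_eval.Comp[where ys = "[y]"]) auto

lemma rec_eval_Comp2:
  "rec_eval g xs y \<Longrightarrow> rec_eval g' xs y' \<Longrightarrow> rec_eval f [y, y'] z \<Longrightarrow>
    rec_eval (Comp f [g, g']) xs z"
  by (rule rec_eval.Comp[where ys = "[y, y']"]) auto

lemma rec_eval_Proj: "i < length xs \<Longrightarrow> xs ! i = y \<Longrightarrow> rec_eval (Proj i) xs y"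
  using rec_eval.Proj by blast

lemma computable_comp: "computable f \<Longrightarrow> computable g \<Longrightarrow> computable (\<lambda>x. f (g x))"
  unfolding computable_def by (meson rec_eval_Comp1)

lemma computable_comp2:
  "computable2 h \<Longrightarrow> computable f \<Longrightarrow> computable g \<Longrightarrow> computable (\<lambda>x. h (f x) (g x))"
  unfolding computable_def computable2_def by (meson rec_eval_Comp2)

lemma computable2_comp1: "computable f \<Longrightarrow> computable2 g \<Longrightarrow> computable2 (\<lambda>x y. f (g x y))"
  unfolding computable_def computable2_def by (meson rec_eval_Comp1)

lemma computable2_comp2:
  "computable2 h \<Longrightarrow> computable2 f \<Longrightarrow> computable2 g \<Longrightarrow> computable2 (\<lambda>x y. h (f x y) (g x y))"
  unfolding computable2_def by (meson rec_eval_Comp2)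

lemma computable3_comp1: "computable f \<Longrightarrow> computable3 g \<Longrightarrow> computable3 (\<lambda>x y z. f (g x y z))"
  unfolding computable_def computable3_def by (meson rec_eval_Comp1)

lemma computable3_comp2:
  "computable2 h \<Longrightarrow> computable3 f \<Longrightarrow> computable3 g \<Longrightarrow>
    computable3 (\<lambda>x y z. h (f x y z) (g x y z))"
  unfolding computable2_def computable3_def by (meson rec_eval_Comp2)

lemma computable_id [computable_intros]: "computable (\<lambda>x. x)"
  unfolding computable_def by (rule exI[of _ "Proj 0"]) (auto intro: rec_eval_Proj)

lemma computable2_proj: "computable2 (\<lambda>x y. x)" "computable2 (\<lambda>x y. y)"
  unfolding computable2_def
  by (rule exI[of _ "Proj 0"], auto intro: rec_eval_Proj)
     (rule exI[of _ "Proj 1"], auto intro: rec_eval_Proj)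

lemma computable3_proj:
  "computable3 (\<lambda>x y z. x)" "computable3 (\<lambda>x y z. y)" "computable3 (\<lambda>x y z. z)"
  unfolding computable3_def
  by (rule exI[of _ "Proj 0"], auto intro: rec_eval_Proj)
     (rule exI[of _ "Proj 1"], auto intro: rec_eval_Proj,
      rule exI[of _ "Proj 2"], auto intro: rec_eval_Proj)

lemma computable_succ: "computable Suc"
  unfolding computable_def by (rule exI[of _ recf.Succ]) (auto intro: rec_eval.Succ)

lemmas computable_Suc [computable_intros] = computable_comp[OF computable_succ]

lemma computable_const [computable_intros]: "computable (\<lambda>_. n)"
proof (induction n)
  case 0
  show ?case
    unfolding computable_def by (rule exI[of _ recf.Zero]) (auto intro: rec_eval.Zero)
next
  case (Suc n)
  then show ?case by (rule computable_Suc)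
qed

lemma computable2_rec_nat:
  assumes "computable f" "computable3 g"
  shows "computable2 (\<lambda>n x. rec_nat (f x) (\<lambda>m y. g m y x) n)"
proof -
  obtain F where F: "\<And>x. rec_eval F [x] (f x)"
    using assms(1) unfolding computable_def by blast
  obtain G where G: "\<And>x y z. rec_eval G [x, y, z] (g x y z)"
    using assms(2) unfolding computable3_def by blast
  have "rec_eval (Prec F G) [n, x] (rec_nat (f x) (\<lambda>m y. g m y x) n)" for n x
    by (induction n) (auto intro: rec_eval.Prec_0 rec_eval.Prec_Suc F G)
  then show ?thesis unfolding computable2_def by blast
qed

lemma computable2_add: "computable2 (+)"
proof -
  have "rec_nat x (\<lambda>m y. Suc y) n = n + x" for n x :: nat
    by (induction n) auto
  with computable2_rec_nat[OF computable_id computable3_comp1[OF computable_succ computable3_proj(2)]]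
  show ?thesis by simp
qed

lemmas computable_add [computable_intros] = computable_comp2[OF computable2_add]

lemma computable2_mult: "computable2 (*)"
proof -
  have "rec_nat 0 (\<lambda>m y. y + x) n = n * x" for n x :: nat
    by (induction n) auto
  with computable2_rec_nat[OF computable_const[of 0]
      computable3_comp2[OF computable2_add computable3_proj(2,3)]]
  show ?thesis by simp
qed

lemmas computable_mult [computable_intros] = computable_comp2[OF computable2_mult]

lemma computable_pred: "computable (\<lambda>n. n - 1)"
proof -
  have "rec_nat 0 (\<lambda>m y. m) n = n - 1" for n :: nat
    by (cases n) auto
  with computable2_rec_nat[OF computable_const[of 0] computable3_proj(1)]
  have "computable2 (\<lambda>n x. n - 1)" by simp
  \<comment> \<open>Recursion with a parameter yields a binary function; identifying its arguments
    gives the unary one.\<close>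
  from computable_comp2[OF this computable_id computable_id] show ?thesis .
qed

lemma computable2_diff: "computable2 (-)"
proof -
  have "rec_nat x (\<lambda>m y. y - 1) n = x - n" for n x :: nat
    by (induction n) auto
  with computable2_rec_nat[OF computable_id computable3_comp1[OF computable_pred computable3_proj(2)]]
  have "computable2 (\<lambda>n x. x - n)" by simp
  \<comment> \<open>The recursion runs on the subtrahend, so the arguments come out swapped.\<close>
  from computable2_comp2[OF this computable2_proj(2,1)] show ?thesis .
qed

lemmas computable_diff [computable_intros] = computable_comp2[OF computable2_diff]

lemma computable_triangle: "computable triangle"
proof -
  have "rec_nat 0 (\<lambda>m y. Suc m + y) n = triangle n" for n
    by (induction n) auto
  with computable2_rec_nat[OF computable_const[of 0]
      computable3_comp2[OF computable2_add computable3_comp1[OF computable_succ computable3_proj(1)]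
        computable3_proj(2)]]
  have "computable2 (\<lambda>n x. triangle n)" by simp
  from computable_comp2[OF this computable_id computable_id] show ?thesis .
qed

lemma computable2_prod_encode: "computable2 (\<lambda>a b. prod_encode (a, b))"
  unfolding prod_encode_def using computable2_add computable2_proj computable_triangle
  by (auto intro!: computable2_comp2[of "(+)"] computable2_comp1[of triangle])

lemmas computable_prod_encode [computable_intros] = computable_comp2[OF computable2_prod_encode]

lemma computable_Least_zero:
  assumes "computable2 g" and ex: "\<And>x. \<exists>n. g n x = 0"
  shows "computable (\<lambda>x. LEAST n. g n x = 0)"
proof -
  obtain G where G: "\<And>x y. rec_eval G [x, y] (g x y)"
    using assms(1) unfolding computable2_def by blast
  have "rec_eval (Mu G) [x] (LEAST n. g n x = 0)" for x
  proof (rule rec_eval.Mu)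
    show "rec_eval G [LEAST n. g n x = 0, x] 0"
      using LeastI_ex[OF ex[of x]] G[of "LEAST n. g n x = 0" x] by simp
    show "\<exists>y. rec_eval G [m, x] (Suc y)" if "m < (LEAST n. g n x = 0)" for m
      using not_less_Least[OF that] G[of m x] by (cases "g m x") auto
  qed
  then show ?thesis unfolding computable_def by blast
qed

abbreviation pfst :: "nat \<Rightarrow> nat" where "pfst x \<equiv> fst (prod_decode x)"

abbreviation psnd :: "nat \<Rightarrow> nat" where "psnd x \<equiv> snd (prod_decode x)"

text \<open>Since \<open>prod_encode (a, b) = triangle (a + b) + a\<close>, the diagonal
  \<open>a + b\<close> is the least \<open>n\<close> whose \<open>triangle (Suc n)\<close> exceeds
  the code. Truncated subtraction turns this inequality into the zero test that \<open>Mu\<close>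
  performs; the diagonal then yields both components.\<close>

lemma prod_encode_diagonal: "(LEAST n. Suc (prod_encode (a, b)) - triangle (Suc n) = 0) = a + b"
proof (rule Least_equality)
  show "Suc (prod_encode (a, b)) - triangle (Suc (a + b)) = 0"
    by (simp add: prod_encode_def)
  fix n assume n: "Suc (prod_encode (a, b)) - triangle (Suc n) = 0"
  show "a + b \<le> n"
  proof (rule ccontr)
    assume "\<not> a + b \<le> n"
    then have "Suc n \<le> a + b" by simp
    then have "triangle (Suc n) \<le> triangle (a + b)"
      by (rule lift_Suc_mono_le[rotated]) simp
    with n show False by (simp add: prod_encode_def)
  qed
qed

lemma computable_pfst_psnd: "computable pfst" "computable psnd"
proof -
  let ?k = "\<lambda>x. LEAST n. Suc x - triangle (Suc n) = 0"
  have ex: "\<exists>n. Suc x - triangle (Suc n) = 0" for x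
  proof -
    obtain a b where "x = prod_encode (a, b)" by (metis prod_decode_inverse surj_pair)
    then show ?thesis by (intro exI[of _ "a + b"]) (simp add: prod_encode_def)
  qed
  have k: "computable ?k"
    using computable2_comp2[OF computable2_diff
        computable2_comp1[OF computable_succ computable2_proj(2)]
        computable2_comp1[OF computable_triangle computable2_comp1[OF computable_succ computable2_proj(1)]]]
    by (rule computable_Least_zero) (rule ex)
  have fst: "pfst x = x - triangle (?k x)" and snd: "psnd x = ?k x - pfst x" for x
  proof -
    obtain a b where x: "x = prod_encode (a, b)" by (metis prod_decode_inverse surj_pair)
    have "?k x = a + b" unfolding x by (rule prod_encode_diagonal)
    then show "pfst x = x - triangle (?k x)" and "psnd x = ?k x - pfst x"
      by (simp_all add: x) (simp add: prod_encode_def)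
  qed
  show pfst: "computable pfst"
    unfolding fst[abs_def] by (intro computable_intros computable_comp[OF computable_triangle] k)
  show "computable psnd"
    unfolding snd[abs_def] by (intro computable_intros k pfst)
qed

lemmas computable_pfst [computable_intros] = computable_comp[OF computable_pfst_psnd(1)]
lemmas computable_psnd [computable_intros] = computable_comp[OF computable_pfst_psnd(2)]

text \<open>
  From here on all functions are unary: the variables in scope are kept in one number, and a
  binder pushes its bound variable by pairing.
\<close>

lemma computable_rec_nat [computable_intros]:
  assumes "computable f" "computable (\<lambda>w. g (pfst w) (pfst (psnd w)) (psnd (psnd w)))" "computable h"
  shows "computable (\<lambda>x. rec_nat (f x) (\<lambda>n y. g n y x) (h x))"
proof -
  have "computable3 (\<lambda>n y x. prod_encode (n, prod_encode (y, x)))"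
    by (intro computable3_comp2[OF computable2_prod_encode] computable3_proj)
  from computable3_comp1[OF assms(2) this] have "computable3 g" by simp
  from computable2_rec_nat[OF assms(1) this] show ?thesis
    using computable_comp2 assms(3) computable_id by blast
qed

section \<open>Decidable predicates, search and bounded quantifiers\<close>

definition decidable :: "(nat \<Rightarrow> bool) \<Rightarrow> bool" where
  "decidable P \<longleftrightarrow> computable (\<lambda>x. if P x then 1 else 0)"

lemma decidable_less [computable_intros]:
  assumes "computable f" "computable g"
  shows "decidable (\<lambda>x. f x < g x)"
proof -
  \<comment> \<open>With truncated subtraction, \<open>1 - (1 - z)\<close> is the sign of
    \<open>z\<close>.\<close>
  have eq: "(if f x < g x then 1 else 0) = 1 - (1 - (g x - f x))" for x by auto
  show ?thesis unfolding decidable_def eq by (intro computable_intros assms)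
qed

lemma decidable_not [computable_intros]:
  assumes "decidable P"
  shows "decidable (\<lambda>x. \<not> P x)"
proof -
  have eq: "(if \<not> P x then 1 else 0) = 1 - (if P x then 1 else (0::nat))" for x by auto
  show ?thesis
    using assms unfolding decidable_def eq by (intro computable_diff computable_const)
qed

lemma decidable_conj [computable_intros]:
  assumes "decidable P" "decidable Q"
  shows "decidable (\<lambda>x. P x \<and> Q x)"
proof -
  have eq: "(if P x \<and> Q x then 1 else 0) = (if P x then 1 else 0) * (if Q x then 1 else (0::nat))" for x
    by auto
  show ?thesis using assms unfolding decidable_def eq by (rule computable_mult)
qed

lemma decidable_disj [computable_intros]:
  assumes "decidable P" "decidable Q"
  shows "decidable (\<lambda>x. P x \<or> Q x)"
proof -
  have "decidable (\<lambda>x. \<not> (\<not> P x \<and> \<not> Q x))" by (intro computable_intros assms)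
  then show ?thesis by simp
qed

lemma decidable_imp [computable_intros]:
  assumes "decidable P" "decidable Q"
  shows "decidable (\<lambda>x. P x \<longrightarrow> Q x)"
proof -
  have "decidable (\<lambda>x. \<not> P x \<or> Q x)" by (intro computable_intros assms)
  then show ?thesis by simp
qed

lemma decidable_le [computable_intros]:
  assumes "computable f" "computable g"
  shows "decidable (\<lambda>x. f x \<le> g x)"
  unfolding not_less[symmetric] by (intro computable_intros assms)

lemma decidable_eq [computable_intros]:
  assumes "computable f" "computable g"
  shows "decidable (\<lambda>x. f x = g x)"
  unfolding order_eq_iff by (intro computable_intros assms)

lemma computable_if [computable_intros]:
  assumes "decidable P" "computable f" "computable g"
  shows "computable (\<lambda>x. if P x then f x else g x)"
proof -
  have eq: "(if P x then f x else g x) =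
      (if P x then 1 else 0) * f x + (1 - (if P x then 1 else (0::nat))) * g x" for x
    by auto
  show ?thesis
    unfolding eq
    by (intro computable_add computable_mult computable_diff computable_const assms
        assms(1)[unfolded decidable_def])
qed

lemma computable_Least [computable_intros]:
  assumes "decidable (\<lambda>w. P (pfst w) (psnd w))" and ex: "\<And>x. \<exists>n. P n x"
  shows "computable (\<lambda>x. LEAST n. P n x)"
proof -
  have "computable (\<lambda>w. if P (pfst w) (psnd w) then 0 else 1)"
    by (intro computable_intros assms(1))
  from computable2_comp1[OF this computable2_prod_encode]
  have "computable2 (\<lambda>n x. if P n x then 0 else 1)" by simp
  from computable_Least_zero[OF this] ex
  have "computable (\<lambda>x. LEAST n. (if P n x then 0 else (1::nat)) = 0)" by simp
  moreover have "((if P n x then 0 else (1::nat)) = 0) = P n x" for n x by simp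
  ultimately show ?thesis by simp
qed

text \<open>A search for a witness that also accepts any \<open>i\<close> with
  \<open>f x \<le> i\<close> always stops, at \<open>f x\<close> at the latest. A witness below
  \<open>f x\<close> exists exactly when it stops earlier.\<close>

lemma decidable_bex [computable_intros]:
  assumes "computable f" "decidable (\<lambda>w. P (pfst w) (psnd w))"
  shows "decidable (\<lambda>x. \<exists>i<f x. P i x)"
proof -
  have "(\<exists>i<f x. P i x) \<longleftrightarrow> (LEAST i. f x \<le> i \<or> P i x) < f x" for x
  proof
    assume "\<exists>i<f x. P i x"
    then obtain i where i: "i < f x" "P i x" by blast
    then have "(LEAST i. f x \<le> i \<or> P i x) \<le> i" by (intro Least_le) simp
    with i(1) show "(LEAST i. f x \<le> i \<or> P i x) < f x" by simp
  next
    assume l: "(LEAST i. f x \<le> i \<or> P i x) < f x"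
    have "f x \<le> (LEAST i. f x \<le> i \<or> P i x) \<or> P (LEAST i. f x \<le> i \<or> P i x) x"
      by (rule LeastI[of _ "f x"]) simp
    with l show "\<exists>i<f x. P i x" by (meson not_le)
  qed
  moreover have "decidable (\<lambda>x. (LEAST i. f x \<le> i \<or> P i x) < f x)"
    by (intro computable_intros assms computable_comp[OF assms(1)]) (use le_refl in blast)
  ultimately show ?thesis by simp
qed

lemma decidable_ball [computable_intros]:
  assumes "computable f" "decidable (\<lambda>w. P (pfst w) (psnd w))"
  shows "decidable (\<lambda>x. \<forall>i<f x. P i x)"
proof -
  have "decidable (\<lambda>x. \<not> (\<exists>i<f x. \<not> P i x))" by (intro computable_intros assms)
  then show ?thesis by simp
qed

lemma computable_div [computable_intros]:
  assumes "computable f" "computable g"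
  shows "computable (\<lambda>x. f x div g x)"
proof -
  \<comment> \<open>The disjunct \<open>g x = 0\<close> ends the search at \<open>q = 0\<close>, in
    agreement with the value 0 of division by zero.\<close>
  have eq: "f x div g x = (LEAST q. g x = 0 \<or> f x < g x * Suc q)" for x
  proof (rule Least_equality[symmetric])
    show "g x = 0 \<or> f x < g x * Suc (f x div g x)"
      using dividend_less_times_div[of "g x" "f x"] by auto
    show "f x div g x \<le> q" if "g x = 0 \<or> f x < g x * Suc q" for q
    proof (cases "g x = 0")
      case False
      with that have "f x < Suc q * g x" by (simp add: mult.commute)
      then have "f x div g x < Suc q" by (rule less_mult_imp_div_less)
      then show ?thesis by simp
    qed simp
  qed
  have "\<exists>q. g x = 0 \<or> f x < g x * Suc q" for x
    by (rule exI[of _ "f x"]) (cases "g x", auto)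
  then show ?thesis
    unfolding eq by (intro computable_intros assms computable_comp[OF assms(1)] computable_comp[OF assms(2)])
qed

lemma computable_mod [computable_intros]:
  assumes "computable f" "computable g"
  shows "computable (\<lambda>x. f x mod g x)"
  unfolding minus_mult_div_eq_mod[symmetric] by (intro computable_intros assms)

lemma computable_power [computable_intros]:
  assumes "computable f" "computable g"
  shows "computable (\<lambda>x. f x ^ g x)"
proof -
  have "f x ^ g x = rec_nat 1 (\<lambda>n y. f x * y) (g x)" for x
  proof -
    have "y ^ n = rec_nat 1 (\<lambda>n z. y * z) n" for y n :: nat by (induction n) auto
    then show ?thesis by blast
  qed
  then show ?thesis by (simp only:) (intro computable_intros assms computable_comp[OF assms(1)])
qed

lemma decidable_set_decode [computable_intros]:
  assumes "computable f" "computable g"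
  shows "decidable (\<lambda>x. f x \<in> set_decode (g x))"
proof -
  have "f x \<in> set_decode (g x) \<longleftrightarrow> g x div 2 ^ f x mod 2 = 1" for x
    by (simp add: set_decode_def odd_iff_mod_2_eq_one)
  then show ?thesis by (simp only:) (intro computable_intros assms)
qed

section \<open>Derivations\<close>

abbreviation pair :: "nat \<Rightarrow> nat \<Rightarrow> nat" where "pair a b \<equiv> prod_encode (a, b)"

abbreviation cons :: "nat \<Rightarrow> nat \<Rightarrow> nat" where "cons x xs \<equiv> Suc (pair x xs)"

fun recf_encode :: "recf \<Rightarrow> nat" where
  "recf_encode recf.Zero = pair 0 0"
| "recf_encode recf.Succ = pair 1 0"
| "recf_encode (Proj i) = pair 2 i"
| "recf_encode (Comp f gs) = pair 3 (pair (recf_encode f) (list_encode (map recf_encode gs)))"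
| "recf_encode (Prec f g) = pair 4 (pair (recf_encode f) (recf_encode g))"
| "recf_encode (Mu f) = pair 5 (recf_encode f)"

text \<open>
  The number \<open>entry p xs y\<close> codes the claim that program \<open>p\<close> has value \<open>y\<close> at \<open>xs\<close>. The extra
  programs \<open>pair 6 gs\<close> evaluate a list \<open>gs\<close> of programs to the list of their values.
\<close>

abbreviation entry :: "nat \<Rightarrow> nat \<Rightarrow> nat \<Rightarrow> nat" where "entry p xs y \<equiv> pair p (pair xs y)"

inductive justified :: "nat set \<Rightarrow> nat \<Rightarrow> bool" for A where
  Zero: "justified A (entry (pair 0 0) xs 0)"
| Succ: "justified A (entry (pair 1 0) (cons x 0) (Suc x))"
| Proj_0: "justified A (entry (pair 2 0) (cons x xs) x)"
| Proj_Suc: "entry (pair 2 i) xs y \<in> A \<Longrightarrow> justified A (entry (pair 2 (Suc i)) (cons x xs) y)"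
| Comp: "entry (pair 6 gs) xs ys \<in> A \<Longrightarrow> entry f ys z \<in> A \<Longrightarrow>
    justified A (entry (pair 3 (pair f gs)) xs z)"
| Prec_0: "entry f xs y \<in> A \<Longrightarrow> justified A (entry (pair 4 (pair f g)) (cons 0 xs) y)"
| Prec_Suc: "entry (pair 4 (pair f g)) (cons n xs) y \<in> A \<Longrightarrow>
    entry g (cons n (cons y xs)) z \<in> A \<Longrightarrow>
    justified A (entry (pair 4 (pair f g)) (cons (Suc n) xs) z)"
| Mu: "entry f (cons n xs) 0 \<in> A \<Longrightarrow> \<forall>m<n. \<exists>y. entry f (cons m xs) (Suc y) \<in> A \<Longrightarrow>
    justified A (entry (pair 5 f) xs n)"
| Nil: "justified A (entry (pair 6 0) xs 0)"
| Cons: "entry g xs y \<in> A \<Longrightarrow> entry (pair 6 gs) xs ys \<in> A \<Longrightarrow>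
    justified A (entry (pair 6 (cons g gs)) xs (cons y ys))"

text \<open>The rules use membership in \<open>A\<close> only positively. This is what allows
  derivations to be merged by taking unions.\<close>

lemma justified_mono: "justified A j \<Longrightarrow> A \<subseteq> B \<Longrightarrow> justified B j"
  by (induction rule: justified.induct) (blast intro: justified.intros)+

inductive_cases justified_ZeroE: "justified A (entry (pair 0 0) xs y)"
inductive_cases justified_SuccE: "justified A (entry (pair (Suc 0) 0) xs y)"
inductive_cases justified_Proj_0E: "justified A (entry (pair 2 0) xs y)"
inductive_cases justified_Proj_SucE: "justified A (entry (pair 2 (Suc i)) xs y)"
inductive_cases justified_CompE: "justified A (entry (pair 3 (pair f gs)) xs y)"
inductive_cases justified_PrecE: "justified A (entry (pair 4 (pair f g)) xs y)"
inductive_cases justified_MuE: "justified A (entry (pair 5 f) xs y)"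
inductive_cases justified_NilE: "justified A (entry (pair 6 0) xs y)"
inductive_cases justified_ConsE: "justified A (entry (pair 6 (cons g gs)) xs y)"

lemma list_encode_eq_0: "list_encode xs = 0 \<longleftrightarrow> xs = []"
  by (cases xs) auto

lemma list_encode_eq_cons:
  "list_encode xs = cons y ys \<longleftrightarrow> (\<exists>zs. xs = y # zs \<and> list_encode zs = ys)"
  by (cases xs) auto

text \<open>
  A set closed under justification is sound: premises of an entry concern smaller programs, or
  the same program with a smaller first argument, so circular justifications cannot occur.
\<close>

lemma justified_sound:
  assumes A: "\<And>j. j \<in> A \<Longrightarrow> justified A j"
  shows "entry (recf_encode r) (list_encode xs) y \<in> A \<Longrightarrow> rec_eval r xs y"
proof (induction r arbitrary: xs y)
  case Zero
  from A[OF this] show ?case by (auto elim: justified_ZeroE intro: rec_eval.Zero)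
next
  case Succ
  from A[OF this] show ?case
    by (auto elim!: justified_SuccE intro: rec_eval.Succ simp: list_encode_eq_cons list_encode_eq_0)
next
  case (Proj i)
  have "entry (pair 2 i) (list_encode xs) y \<in> A \<Longrightarrow> i < length xs \<and> xs ! i = y"
  proof (induction i arbitrary: xs)
    case 0
    from A[OF this] show ?case by (auto elim!: justified_Proj_0E simp: list_encode_eq_cons)
  next
    case (Suc i)
    from A[OF Suc.prems] Suc.IH show ?case
      by (auto elim!: justified_Proj_SucE simp: list_encode_eq_cons)
  qed
  with Proj show ?case by (auto intro: rec_eval_Proj)
next
  case (Comp f gs)
  \<comment> \<open>The outer induction hypotheses cover the members of \<open>gs\<close>. Stating
    the claim for all lists \<open>hs\<close> with members from \<open>gs\<close> lets the inner
    induction pass to tails.\<close>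
  have vals: "\<exists>vs. ys = list_encode vs \<and> list_all2 (\<lambda>g. rec_eval g xs) hs vs"
    if "entry (pair 6 (list_encode (map recf_encode hs))) (list_encode xs) ys \<in> A" "set hs \<subseteq> set gs"
    for hs ys
    using that
  proof (induction hs arbitrary: ys)
    case Nil
    from A[OF Nil(1)] show ?case by (auto elim: justified_NilE simp: list_encode_eq_0)
  next
    case (Cons h hs)
    from A[OF Cons.prems(1)] obtain v vs' where vs: "ys = cons v vs'"
        "entry (recf_encode h) (list_encode xs) v \<in> A"
        "entry (pair 6 (list_encode (map recf_encode hs))) (list_encode xs) vs' \<in> A"
      by (auto elim!: justified_ConsE)
    from Cons.IH[OF vs(3)] Cons.prems(2) obtain vs where
      "vs' = list_encode vs" "list_all2 (\<lambda>g. rec_eval g xs) hs vs" by auto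
    with Comp.IH(2)[OF _ vs(2)] Cons.prems(2) vs(1) show ?case
      by (intro exI[of _ "v # vs"]) auto
  qed
  from A[OF Comp.prems] obtain ys where ys:
    "entry (pair 6 (list_encode (map recf_encode gs))) (list_encode xs) ys \<in> A"
    "entry (recf_encode f) ys y \<in> A"
    by (auto elim: justified_CompE)
  from vals[OF ys(1)] obtain vs where "ys = list_encode vs" "list_all2 (\<lambda>g. rec_eval g xs) gs vs"
    by auto
  with ys(2) Comp.IH(1) show ?case by (auto intro: rec_eval.Comp)
next
  case (Prec f g)
  have "rec_eval (Prec f g) (n # zs) y"
    if "entry (pair 4 (pair (recf_encode f) (recf_encode g))) (list_encode (n # zs)) y \<in> A" for n zs y
    using that
  proof (induction n arbitrary: y)
    case 0
    from A[OF 0] Prec.IH(1) show ?case by (auto elim!: justified_PrecE intro: rec_eval.Prec_0)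
  next
    case (Suc n)
    from A[OF Suc.prems] obtain v where
      "entry (pair 4 (pair (recf_encode f) (recf_encode g))) (list_encode (n # zs)) v \<in> A"
      "entry (recf_encode g) (list_encode (n # v # zs)) y \<in> A"
      by (auto elim!: justified_PrecE)
    with Suc.IH Prec.IH(2) show ?case by (blast intro: rec_eval.Prec_Suc)
  qed
  moreover obtain n zs where "xs = n # zs"
    using A[OF Prec.prems] by (auto elim!: justified_PrecE simp: list_encode_eq_cons)
  ultimately show ?case using Prec.prems by simp
next
  case (Mu f)
  from A[OF Mu.prems] have "entry (recf_encode f) (list_encode (y # xs)) 0 \<in> A"
    "\<forall>m<y. \<exists>z. entry (recf_encode f) (list_encode (m # xs)) (Suc z) \<in> A"
    by (auto elim!: justified_MuE)
  with Mu.IH show ?case by (meson rec_eval.Mu)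
qed

section \<open>Finite derivations and their completeness for evaluation\<close>

definition derivable :: "nat \<Rightarrow> bool" where
  "derivable j \<longleftrightarrow> (\<exists>A. finite A \<and> (\<forall>i\<in>A. justified A i) \<and> j \<in> A)"

text \<open>By monotonicity, the derivations of the finitely many premises together with
  \<open>j\<close> form one derivation. Finiteness is maintained so that a derivation can be coded
  as a number.\<close>

lemma derivable_justified:
  assumes "finite S" "\<And>i. i \<in> S \<Longrightarrow> derivable i" "justified S j"
  shows "derivable j"
proof -
  from assms(2) obtain A where A: "\<And>i. i \<in> S \<Longrightarrow> finite (A i) \<and> (\<forall>k\<in>A i. justified (A i) k) \<and> i \<in> A i"
    unfolding derivable_def by metis
  let ?B = "insert j (\<Union>i\<in>S. A i)"
  have "S \<subseteq> ?B" using A by auto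
  with assms(3) have "justified ?B j" by (rule justified_mono)
  moreover have "justified ?B k" if "i \<in> S" "k \<in> A i" for i k
    by (rule justified_mono[of "A i"]) (use A[OF that(1)] that in auto)
  ultimately have "\<forall>k\<in>?B. justified ?B k" by auto
  moreover have "finite ?B" using A assms(1) by auto
  ultimately show ?thesis unfolding derivable_def by (intro exI[of _ ?B]) simp
qed

lemma
  shows derivable_Zero: "derivable (entry (pair 0 0) xs 0)"
    and derivable_Succ: "derivable (entry (pair 1 0) (cons x 0) (Suc x))"
    and derivable_Proj_0: "derivable (entry (pair 2 0) (cons x xs) x)"
    and derivable_Proj_Suc: "derivable (entry (pair 2 i) xs y) \<Longrightarrow>
      derivable (entry (pair 2 (Suc i)) (cons x xs) y)"
    and derivable_Comp: "derivable (entry (pair 6 gs) xs ys) \<Longrightarrow> derivable (entry f ys z) \<Longrightarrow>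
      derivable (entry (pair 3 (pair f gs)) xs z)"
    and derivable_Prec_0: "derivable (entry f xs y) \<Longrightarrow>
      derivable (entry (pair 4 (pair f g)) (cons 0 xs) y)"
    and derivable_Prec_Suc: "derivable (entry (pair 4 (pair f g)) (cons n xs) y) \<Longrightarrow>
      derivable (entry g (cons n (cons y xs)) z) \<Longrightarrow>
      derivable (entry (pair 4 (pair f g)) (cons (Suc n) xs) z)"
    and derivable_Nil: "derivable (entry (pair 6 0) xs 0)"
    and derivable_Cons: "derivable (entry g xs y) \<Longrightarrow> derivable (entry (pair 6 gs) xs ys) \<Longrightarrow>
      derivable (entry (pair 6 (cons g gs)) xs (cons y ys))"
  subgoal by (rule derivable_justified[OF _ _ justified.Zero[of "{}"]]) auto
  subgoal by (rule derivable_justified[OF _ _ justified.Succ[of "{}"]]) auto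
  subgoal by (rule derivable_justified[OF _ _ justified.Proj_0[of "{}"]]) auto
  subgoal by (rule derivable_justified[OF _ _ justified.Proj_Suc[OF singletonI]]) auto
  subgoal by (rule derivable_justified[OF _ _ justified.Comp[OF insertI1 insertI2[OF singletonI]]]) auto
  subgoal by (rule derivable_justified[OF _ _ justified.Prec_0[OF singletonI]]) auto
  subgoal by (rule derivable_justified[OF _ _ justified.Prec_Suc[OF insertI1 insertI2[OF singletonI]]]) auto
  subgoal by (rule derivable_justified[OF _ _ justified.Nil[of "{}"]]) auto
  subgoal by (rule derivable_justified[OF _ _ justified.Cons[OF insertI1 insertI2[OF singletonI]]]) auto
  done

lemma derivable_Mu:
  assumes "derivable (entry f (cons n xs) 0)"
    and "\<And>m. m < n \<Longrightarrow> derivable (entry f (cons m xs) (Suc (v m)))"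
  shows "derivable (entry (pair 5 f) xs n)"
  by (rule derivable_justified[of "insert (entry f (cons n xs) 0)
      ((\<lambda>m. entry f (cons m xs) (Suc (v m))) ` {..<n})", OF _ _ justified.Mu])
    (use assms in auto)

lemma rec_eval_derivable:
  "rec_eval r xs y \<Longrightarrow> derivable (entry (recf_encode r) (list_encode xs) y)"
proof (induction rule: rec_eval.induct)
  case (Zero xs)
  show ?case unfolding recf_encode.simps by (rule derivable_Zero)
next
  case (Succ x)
  show ?case unfolding recf_encode.simps list_encode.simps by (rule derivable_Succ)
next
  case (Proj i xs)
  then show ?case
  proof (induction xs arbitrary: i)
    case Nil
    then show ?case by simp
  next
    case (Cons x xs)
    show ?case
    proof (cases i)
      case 0
      show ?thesis
        unfolding 0 recf_encode.simps list_encode.simps nth_Cons_0 by (rule derivable_Proj_0)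
    next
      case (Suc k)
      have "derivable (entry (recf_encode (Proj k)) (list_encode xs) (xs ! k))"
        by (rule Cons.IH) (use Cons.prems Suc in simp)
      then show ?thesis
        unfolding Suc recf_encode.simps list_encode.simps nth_Cons_Suc by (rule derivable_Proj_Suc)
    qed
  qed
next
  case (Comp xs gs ys f z)
  from Comp.IH(1) have
    "derivable (entry (pair 6 (list_encode (map recf_encode gs))) (list_encode xs) (list_encode ys))"
  proof (induction rule: list_all2_induct)
    case Nil
    show ?case unfolding list.map list_encode.simps by (rule derivable_Nil)
  next
    case (Cons g gs y ys)
    then show ?case
      unfolding list.map list_encode.simps by (intro derivable_Cons) simp_all
  qed
  with Comp.IH(2) show ?case unfolding recf_encode.simps by (intro derivable_Comp)
next
  case (Prec_0 f xs y g)
  from Prec_0.IH show ?case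
    unfolding recf_encode.simps list_encode.simps by (rule derivable_Prec_0)
next
  case (Prec_Suc f g n xs y z)
  from Prec_Suc.IH show ?case
    unfolding recf_encode.simps list_encode.simps by (rule derivable_Prec_Suc)
next
  case (Mu f n xs)
  then obtain v where v:
    "\<And>m. m < n \<Longrightarrow> derivable (entry (recf_encode f) (list_encode (m # xs)) (Suc (v m)))"
    by metis
  from Mu.IH(1) v show ?case
    unfolding recf_encode.simps list_encode.simps by (rule derivable_Mu)
qed

section \<open>Decidability of coded derivations\<close>

lemma less_if_mem_set_decode:
  assumes "j \<in> set_decode D"
  shows "j < D"
proof -
  from assms have "D div 2 ^ j \<noteq> 0" unfolding set_decode_def by (metis even_zero mem_Collect_eq)
  then have "2 ^ j \<le> D" by (simp add: div_eq_0_iff not_less)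
  then show ?thesis using less_exp[of j] by linarith
qed

lemma pair_lessD: "pair a b < n \<Longrightarrow> a < n \<and> b < n"
  using le_prod_encode_1[of a b] le_prod_encode_2[of b a] by linarith

lemma entry_mem_set_decode_less:
  assumes "entry p xs y \<in> set_decode D"
  shows "p < D" "xs < D" "y < D"
  using less_if_mem_set_decode[OF assms] by (auto dest!: pair_lessD Suc_lessD)

text \<open>Each variable that a rule leaves unbounded is a component of \<open>j\<close> or of an
  entry in the coded set, and all of these are below \<open>D\<close>. In this bounded form the
  closure rules for decidable predicates apply.\<close>

lemma justified_iff_bounded:
  assumes "j < D"
  shows "justified (set_decode D) j \<longleftrightarrow>
    (\<exists>xs<D. j = entry (pair 0 0) xs 0) \<or>
    (\<exists>x<D. j = entry (pair 1 0) (cons x 0) (Suc x)) \<or>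
    (\<exists>x<D. \<exists>xs<D. j = entry (pair 2 0) (cons x xs) x) \<or>
    (\<exists>i<D. \<exists>x<D. \<exists>xs<D. \<exists>y<D. j = entry (pair 2 (Suc i)) (cons x xs) y \<and>
      entry (pair 2 i) xs y \<in> set_decode D) \<or>
    (\<exists>f<D. \<exists>gs<D. \<exists>xs<D. \<exists>z<D. j = entry (pair 3 (pair f gs)) xs z \<and>
      (\<exists>ys<D. entry (pair 6 gs) xs ys \<in> set_decode D \<and> entry f ys z \<in> set_decode D)) \<or>
    (\<exists>f<D. \<exists>g<D. \<exists>xs<D. \<exists>y<D. j = entry (pair 4 (pair f g)) (cons 0 xs) y \<and>
      entry f xs y \<in> set_decode D) \<or>
    (\<exists>f<D. \<exists>g<D. \<exists>n<D. \<exists>xs<D. \<exists>z<D. j = entry (pair 4 (pair f g)) (cons (Suc n) xs) z \<and>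
      (\<exists>y<D. entry (pair 4 (pair f g)) (cons n xs) y \<in> set_decode D \<and>
        entry g (cons n (cons y xs)) z \<in> set_decode D)) \<or>
    (\<exists>f<D. \<exists>n<D. \<exists>xs<D. j = entry (pair 5 f) xs n \<and>
      entry f (cons n xs) 0 \<in> set_decode D \<and>
      (\<forall>m<n. \<exists>y<D. entry f (cons m xs) (Suc y) \<in> set_decode D)) \<or>
    (\<exists>xs<D. j = entry (pair 6 0) xs 0) \<or>
    (\<exists>g<D. \<exists>gs<D. \<exists>xs<D. \<exists>y<D. \<exists>ys<D. j = entry (pair 6 (cons g gs)) xs (cons y ys) \<and>
      entry g xs y \<in> set_decode D \<and> entry (pair 6 gs) xs ys \<in> set_decode D)"
    (is "_ \<longleftrightarrow> ?B")
proof
  assume "justified (set_decode D) j"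
  then show ?B
  proof cases
    case (Zero xs)
    with assms show ?thesis by (auto dest!: pair_lessD Suc_lessD)
  next
    case (Succ x)
    with assms show ?thesis by (auto dest!: pair_lessD Suc_lessD)
  next
    case (Proj_0 x xs)
    with assms show ?thesis by (auto dest!: pair_lessD Suc_lessD)
  next
    case (Proj_Suc i xs y x)
    with assms show ?thesis by (auto dest!: pair_lessD Suc_lessD)
  next
    case (Comp gs xs ys f z)
    with assms entry_mem_set_decode_less[OF Comp(2)] show ?thesis by (auto dest!: pair_lessD Suc_lessD)
  next
    case (Prec_0 f xs y g)
    with assms show ?thesis by (auto dest!: pair_lessD Suc_lessD)
  next
    case (Prec_Suc f g n xs y z)
    with assms entry_mem_set_decode_less[OF Prec_Suc(2)] show ?thesis by (auto dest!: pair_lessD Suc_lessD)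
  next
    case (Mu f n xs)
    have "\<forall>m<n. \<exists>y<D. entry f (cons m xs) (Suc y) \<in> set_decode D"
      using Mu(3) entry_mem_set_decode_less(3) Suc_lessD by meson
    with Mu(1,2) assms show ?thesis by (auto dest!: pair_lessD Suc_lessD)
  next
    case (Nil xs)
    with assms show ?thesis by (auto dest!: pair_lessD Suc_lessD)
  next
    case (Cons g xs y gs ys)
    with assms show ?thesis by (auto dest!: pair_lessD Suc_lessD)
  qed
next
  assume ?B
  then show "justified (set_decode D) j"
    by (elim disjE exE conjE; hypsubst) (rule justified.intros; (assumption | blast))+
qed

definition derivation :: "nat \<Rightarrow> bool" where
  "derivation D \<longleftrightarrow> (\<forall>j\<in>set_decode D. justified (set_decode D) j)"

lemma decidable_derivation: "decidable derivation"
proof -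
  have eq: "derivation = (\<lambda>D. \<forall>j<D. j \<in> set_decode D \<longrightarrow> justified (set_decode D) j)"
    by (auto simp: fun_eq_iff derivation_def dest: less_if_mem_set_decode)
  show ?thesis unfolding eq
    \<comment> \<open>\<open>imp_cong\<close> makes the guard \<open>j < D\<close> available, which
      \<open>justified_iff_bounded\<close> demands.\<close>
    by (simp only: justified_iff_bounded cong: imp_cong) (intro computable_intros)
qed

section \<open>The colouring\<close>

text \<open>
  A pair \<open>I = pair u N\<close> stands for the real interval from \<open>u / N\<close> to \<open>(u + 1) / N\<close>.
\<close>

definition lower :: "nat \<Rightarrow> real" where "lower I = real (pfst I) / real (psnd I)"

definition upper :: "nat \<Rightarrow> real" where "upper I = (real (pfst I) + 1) / real (psnd I)"

text \<open>
  For every \<open>\<alpha>\<close> in \<open>refine r I d\<close> the fractional part of \<open>\<alpha> * d\<close> lies between \<open>r / 4\<close> and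
  \<open>(r + 1) / 4\<close>.
\<close>

definition refine :: "nat \<Rightarrow> nat \<Rightarrow> nat \<Rightarrow> nat" where
  "refine r I d = pair (4 * (pfst I * d div psnd I + 1) + r) (4 * d)"

text \<open>
  The number \<open>n\<close> codes a triple \<open>a < b < c\<close> together with a derivation that program \<open>e\<close>
  accepts all three.
\<close>

definition catches :: "nat \<Rightarrow> nat \<Rightarrow> nat \<Rightarrow> bool" where
  "catches e N n \<longleftrightarrow>
    derivation (psnd (psnd (psnd n))) \<and>
    entry e (cons (pfst n) 0) 1 \<in> set_decode (psnd (psnd (psnd n))) \<and>
    entry e (cons (pfst (psnd n)) 0) 1 \<in> set_decode (psnd (psnd (psnd n))) \<and>
    entry e (cons (pfst (psnd (psnd n))) 0) 1 \<in> set_decode (psnd (psnd (psnd n))) \<and>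
    pfst n + 2 * N \<le> pfst (psnd n) \<and>
    pfst n + 8 * (pfst (psnd n) - pfst n) \<le> pfst (psnd (psnd n))"

text \<open>Quarter 1 for the first difference and quarter 2 for the second: these are the relative
  positions that \<open>floor_parity\<close> excludes for three points of one colour.\<close>

definition shrink :: "nat \<Rightarrow> nat \<Rightarrow> nat" where
  "shrink I n =
    refine 2 (refine 1 I (pfst (psnd n) - pfst n)) (pfst (psnd (psnd n)) - pfst n)"

text \<open>The disjunct \<open>t \<le> n\<close> makes the search total; the value \<open>t\<close>
  signals that there is no catch below \<open>t\<close>.\<close>

definition search :: "nat \<Rightarrow> nat \<Rightarrow> nat \<Rightarrow> nat" where
  "search t e I = (LEAST n. t \<le> n \<or> catches e (psnd I) n)"

text \<open>Only the requirements below \<open>k\<close> have acted on \<open>interval t k\<close>,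
  so a requirement never depends on those of lower priority.\<close>

definition interval :: "nat \<Rightarrow> nat \<Rightarrow> nat" where
  "interval t k = rec_nat (pair 0 1)
    (\<lambda>e I. if search t e I < t then shrink I (search t e I) else I) k"

text \<open>The phase is an exact, unreduced fraction that sums the left endpoints of
  \<open>interval y y\<close>. Stage and number of requirements grow together, so every limit
  interval is eventually respected.\<close>

definition phase :: "nat \<Rightarrow> nat" where
  "phase x = rec_nat (pair 0 1)
    (\<lambda>y S. pair (pfst S * psnd (interval y y) + pfst (interval y y) * psnd S)
      (psnd S * psnd (interval y y))) x"

definition colour :: "nat \<Rightarrow> nat" where
  "colour x = 2 * pfst (phase x) div psnd (phase x) mod 2"

section \<open>Computability of the colouring\<close>

lemma decidable_comp: "decidable P \<Longrightarrow> computable f \<Longrightarrow> decidable (\<lambda>x. P (f x))"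
  unfolding decidable_def by (rule computable_comp)

lemma computable_search:
  assumes "computable f" "computable g" "computable h"
  shows "computable (\<lambda>x. search (f x) (g x) (h x))"
proof -
  have "decidable (\<lambda>w. f (psnd w) \<le> pfst w \<or> catches (g (psnd w)) (psnd (h (psnd w))) (pfst w))"
    unfolding catches_def
    by (intro computable_intros decidable_comp[OF decidable_derivation]
        assms[THEN computable_comp])
  then show ?thesis
    unfolding search_def by (rule computable_Least) blast
qed

lemma computable_interval:
  assumes "computable f" "computable g"
  shows "computable (\<lambda>x. interval (f x) (g x))"
  unfolding interval_def shrink_def refine_def
  by (intro computable_intros computable_search assms assms[THEN computable_comp])

lemma computable_colour: "computable colour"
  unfolding colour_def phase_def
  by (intro computable_intros computable_interval)

section \<open>Nested intervals and their limits\<close>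

lemma refine_subset:
  assumes "0 < psnd I" "2 * psnd I \<le> d" "r < 4"
  shows "lower I \<le> lower (refine r I d)" "upper (refine r I d) \<le> upper I"
    "0 < psnd (refine r I d)"
proof -
  \<comment> \<open>The interval starts at u/N and has length 1/N, and w/d is the first multiple of
    1/d beyond u/N. As 2/d \<le> 1/N, the cell from w/d to (w + 1)/d fits inside, and
    \<open>refine\<close> takes one quarter of it.\<close>
  define u N w where "u = pfst I" and "N = psnd I" and "w = u * d div N + 1"
  have N: "0 < N" "2 * N \<le> d" using assms by (simp_all add: N_def)
  then have d: "0 < d" by simp
  have refine: "refine r I d = pair (4 * w + r) (4 * d)"
    by (simp add: refine_def u_def N_def w_def)
  have "u * d < N * w"
    using dividend_less_times_div[OF N(1), of "u * d"] by (simp add: w_def)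
  moreover have "N * w \<le> u * d + N"
    by (simp add: w_def)
  ultimately have "real (u * d) \<le> real (N * w)" "real (N * w) \<le> real (u * d + N)"
    by (simp_all only: of_nat_le_iff)
  then have w: "u * d \<le> real N * w" "real N * w \<le> u * d + N" by simp_all
  have "real u / N \<le> real w / d"
    using w(1) N d by (simp add: field_simps)
  also have "\<dots> \<le> (4 * real w + r) / (4 * d)"
    using d by (simp add: field_simps)
  finally show "lower I \<le> lower (refine r I d)"
    by (simp add: lower_def refine u_def N_def)
  have "(4 * real w + r + 1) / (4 * d) \<le> (real w + 1) / d"
    using d assms(3) by (simp add: field_simps)
  also have "real N * (w + 1) \<le> (u + 1) * real d"
    using w(2) N(2) by (simp add: algebra_simps)
  then have "(real w + 1) / d \<le> (real u + 1) / N"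
    using N d by (simp add: field_simps)
  finally show "upper (refine r I d) \<le> upper I"
    by (simp add: upper_def refine u_def N_def)
  show "0 < psnd (refine r I d)" using d by (simp add: refine)
qed

text \<open>The denominator of \<open>refine 1 I d\<close> is \<open>4 * d\<close>, so the second
  refinement needs \<open>2 * (4 * d) \<le> d'\<close>; hence the factor 8 in
  \<open>catches\<close>.\<close>

lemma catches_refine:
  assumes "catches e (psnd I) n" "0 < psnd I"
  defines "d \<equiv> pfst (psnd n) - pfst n" and "d' \<equiv> pfst (psnd (psnd n)) - pfst n"
  shows "2 * psnd I \<le> d" "2 * psnd (refine 1 I d) \<le> d'"
    "pfst (psnd n) = pfst n + d" "pfst (psnd (psnd n)) = pfst n + d'"
  using assms by (auto simp: catches_def refine_def)

lemma shrink_subset: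
  assumes "catches e (psnd I) n" "0 < psnd I"
  shows "lower I \<le> lower (shrink I n)" "upper (shrink I n) \<le> upper I" "0 < psnd (shrink I n)"
proof -
  note d = catches_refine[OF assms]
  note I = refine_subset[OF assms(2) d(1), of 1]
  note J = refine_subset[OF I(3) d(2), of 2]
  show "lower I \<le> lower (shrink I n)" "upper (shrink I n) \<le> upper I" "0 < psnd (shrink I n)"
    unfolding shrink_def using I J by (simp_all del: One_nat_def)
qed

lemma interval_0: "interval t 0 = pair 0 1"
  by (simp add: interval_def)

lemma interval_Suc:
  "interval t (Suc e) =
    (let I = interval t e in if search t e I < t then shrink I (search t e I) else I)"
  by (simp add: interval_def Let_def)

lemma catches_search: "search t e I < t \<Longrightarrow> catches e (psnd I) (search t e I)"
  using LeastI[of "\<lambda>n. t \<le> n \<or> catches e (psnd I) n" t] unfolding search_def by auto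

lemma interval_pos: "0 < psnd (interval t e)"
  by (induction e) (auto simp: interval_0 interval_Suc Let_def intro: shrink_subset catches_search)

lemma interval_nested:
  assumes "e \<le> k"
  shows "lower (interval t e) \<le> lower (interval t k) \<and> upper (interval t k) \<le> upper (interval t e)"
  using assms
proof (induction k rule: dec_induct)
  case (step k)
  let ?I = "interval t k"
  have "lower ?I \<le> lower (interval t (Suc k)) \<and> upper (interval t (Suc k)) \<le> upper ?I"
    using shrink_subset[OF catches_search interval_pos, of t k t k]
    by (auto simp: interval_Suc Let_def)
  with step.IH show ?case by linarith
qed simp

text \<open>For fixed \<open>I\<close>, every stage beyond the least catch finds exactly that catch,
  so the search result no longer moves.\<close>

lemma search_eq:
  assumes "catches e (psnd I) m"
  obtains n where "catches e (psnd I) n" "\<And>t. n < t \<Longrightarrow> search t e I = n"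
proof
  let ?n = "LEAST n. catches e (psnd I) n"
  show n: "catches e (psnd I) ?n" using assms by (rule LeastI)
  show "search t e I = ?n" if "?n < t" for t
    unfolding search_def
  proof (rule Least_equality)
    show "t \<le> ?n \<or> catches e (psnd I) ?n" using n ..
    show "?n \<le> m" if "t \<le> m \<or> catches e (psnd I) m" for m
      using that \<open>?n < t\<close> by (auto intro: Least_le)
  qed
qed

text \<open>Induction along the priority: once the interval for \<open>e\<close> is final, the
  search of requirement \<open>e\<close> either settles on its least catch or never
  succeeds.\<close>

lemma interval_limit: "\<exists>I t\<^sub>0. \<forall>t\<ge>t\<^sub>0. interval t e = I"
proof (induction e)
  case 0
  show ?case by (simp add: interval_0)
next
  case (Suc e)
  then obtain I t\<^sub>0 where I: "\<And>t. t \<ge> t\<^sub>0 \<Longrightarrow> interval t e = I" by blast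
  show ?case
  proof (cases "\<exists>n. catches e (psnd I) n")
    case True
    then obtain n where n: "\<And>t. n < t \<Longrightarrow> search t e I = n" using search_eq by metis
    have "interval t (Suc e) = shrink I n" if "t \<ge> max t\<^sub>0 (Suc n)" for t
      using that I[of t] n[of t] by (simp add: interval_Suc)
    then show ?thesis by blast
  next
    case False
    then have "interval t (Suc e) = I" if "t \<ge> t\<^sub>0" for t
      using that I[of t] catches_search[of t e I] by (auto simp: interval_Suc)
    then show ?thesis by blast
  qed
qed

section \<open>Slopes and phases as real numbers\<close>

definition slope :: "nat \<Rightarrow> real" where "slope y = lower (interval y y)"

lemma phase_eq:
  "0 < psnd (phase x) \<and> real (pfst (phase x)) / real (psnd (phase x)) = (\<Sum>y<x. slope y)"
proof (induction x)
  case 0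
  show ?case by (simp add: phase_def)
next
  case (Suc x)
  let ?I = "interval x x"
  have pos: "0 < psnd (phase x)" "0 < psnd ?I" using Suc interval_pos by simp_all
  have step: "phase (Suc x) = pair (pfst (phase x) * psnd ?I + pfst ?I * psnd (phase x))
      (psnd (phase x) * psnd ?I)"
    by (simp add: phase_def)
  have "real (pfst (phase (Suc x))) / real (psnd (phase (Suc x))) =
      real (pfst (phase x)) / real (psnd (phase x)) + slope x"
    using pos by (simp add: step slope_def lower_def add_divide_distrib)
  with Suc pos show ?case by (simp add: step)
qed

text \<open>Doubling maps the circle of length 1 to one of length 2, whose two half circles are told
  apart by the parity of the floor.\<close>

lemma colour_eq: "colour x = 0 \<longleftrightarrow> even \<lfloor>2 * (\<Sum>y<x. slope y)\<rfloor>"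
proof -
  have "2 * (\<Sum>y<x. slope y) = real (2 * pfst (phase x)) / real (psnd (phase x))"
    using phase_eq[of x] by simp
  then have "\<lfloor>2 * (\<Sum>y<x. slope y)\<rfloor> = int (2 * pfst (phase x) div psnd (phase x))"
    by (simp only: floor_divide_of_nat_eq)
  then show ?thesis unfolding colour_def even_iff_mod_2_eq_zero[symmetric] by (simp only: even_of_nat)
qed

lemma sum_slope_bounds:
  fixes \<alpha> :: "nat \<Rightarrow> real"
  assumes "\<And>y. y \<ge> x \<Longrightarrow> l \<le> \<alpha> y" "\<And>y. y \<ge> x \<Longrightarrow> \<alpha> y \<le> u"
  shows "l * d \<le> (\<Sum>y<x+d. \<alpha> y) - (\<Sum>y<x. \<alpha> y)" "(\<Sum>y<x+d. \<alpha> y) - (\<Sum>y<x. \<alpha> y) \<le> u * d"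
proof (induction d)
  case (Suc d)
  {
    case 1
    show ?case using Suc(1) assms(1)[of "x + d"] by (simp add: algebra_simps)
  next
    case 2
    show ?case using Suc(2) assms(2)[of "x + d"] by (simp add: algebra_simps)
  }
qed simp_all

text \<open>
  On a circle of length \<open>2\<close>, the three points leave no arc longer than \<open>1\<close> free, so no
  half-open half circle contains them all.
\<close>

lemma floor_parity:
  fixes X Y Z :: real and i j :: int
  assumes "2 * i + 1/2 \<le> Y - X" "Y - X \<le> 2 * i + 1"
    and "2 * j + 1 \<le> Z - X" "Z - X \<le> 2 * j + 3/2"
    and "even \<lfloor>X\<rfloor> \<longleftrightarrow> even \<lfloor>Y\<rfloor>" "even \<lfloor>X\<rfloor> \<longleftrightarrow> even \<lfloor>Z\<rfloor>"
  shows False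
proof -
  have X: "\<lfloor>X\<rfloor> \<le> X" "X < \<lfloor>X\<rfloor> + 1" by linarith+
  have "\<lfloor>Y\<rfloor> = \<lfloor>X\<rfloor> + 2 * i \<or> \<lfloor>Y\<rfloor> = \<lfloor>X\<rfloor> + 2 * i + 1" using assms(1,2) by linarith
  with assms(5) have "\<lfloor>Y\<rfloor> = \<lfloor>X\<rfloor> + 2 * i" by auto
  then have "Y < \<lfloor>X\<rfloor> + 2 * i + 1" by linarith
  moreover have "\<lfloor>Z\<rfloor> = \<lfloor>X\<rfloor> + 2 * j + 1 \<or> \<lfloor>Z\<rfloor> = \<lfloor>X\<rfloor> + 2 * j + 2" using assms(3,4) by linarith
  with assms(6) have "\<lfloor>Z\<rfloor> = \<lfloor>X\<rfloor> + 2 * j + 2" by auto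
  then have "Z \<ge> \<lfloor>X\<rfloor> + 2 * j + 2" by linarith
  \<comment> \<open>With m the floor of X, the bound on Y forces X < m + 1/2, while the bound on Z
    forces X \<ge> m + 1/2.\<close>
  ultimately show False using assms(1,4) by linarith
qed

text \<open>The endpoints of \<open>refine r I d\<close> times \<open>d\<close> are w + r/4 and w +
  (r + 1)/4 for an integer w. Summing \<open>d\<close> slopes between the endpoints confines the
  phase increment to this range; after doubling, the integer part 2 * w is a number of full turns of
  the circle of length 2.\<close>

lemma refine_sum:
  assumes "0 < d" "\<And>y. y \<ge> x \<Longrightarrow> lower (refine r I d) \<le> slope y"
    and "\<And>y. y \<ge> x \<Longrightarrow> slope y \<le> upper (refine r I d)"
  obtains i :: int where "2 * i + r / 2 \<le> 2 * (\<Sum>y<x+d. slope y) - 2 * (\<Sum>y<x. slope y)"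
    "2 * (\<Sum>y<x+d. slope y) - 2 * (\<Sum>y<x. slope y) \<le> 2 * i + (r + 1) / 2"
proof -
  define w where "w = pfst I * d div psnd I + 1"
  have "lower (refine r I d) * d = w + r / 4" "upper (refine r I d) * d = w + (r + 1) / 4"
    using assms(1) unfolding lower_def upper_def refine_def w_def[symmetric]
    by (simp_all add: field_simps)
  with sum_slope_bounds[of x "lower (refine r I d)" slope "upper (refine r I d)" d] assms(2,3)
  show ?thesis by (intro that[of "int w"]) (simp_all add: field_simps)
qed

section \<open>Defeating an infinite computable set\<close>

lemma catches_exists:
  assumes r: "\<And>x. rec_eval r [x] (if x \<in> H then 1 else 0)" and H: "infinite H"
  shows "\<exists>n. catches (recf_encode r) N n"
proof -
  have above: "\<exists>x\<in>H. m \<le> x" for m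
    using H infinite_nat_iff_unbounded_le by blast
  obtain a where a: "a \<in> H" using above by blast
  obtain b where b: "b \<in> H" "a + 2 * N \<le> b" using above by blast
  obtain c where c: "c \<in> H" "a + 8 * (b - a) \<le> c" using above by blast
  have "\<exists>A. finite A \<and> (\<forall>i\<in>A. justified A i) \<and> entry (recf_encode r) (cons x 0) 1 \<in> A"
    if "x \<in> H" for x
    using rec_eval_derivable[OF r[of x]] that by (simp add: derivable_def)
  then obtain A where A: "\<And>x. x \<in> H \<Longrightarrow> finite (A x)"
      "\<And>x i. x \<in> H \<Longrightarrow> i \<in> A x \<Longrightarrow> justified (A x) i"
      "\<And>x. x \<in> H \<Longrightarrow> entry (recf_encode r) (cons x 0) 1 \<in> A x"
    by metis
  let ?U = "A a \<union> A b \<union> A c"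
  have "finite ?U" using A(1) a b(1) c(1) by simp
  then have D: "set_decode (set_encode ?U) = ?U" by (rule set_encode_inverse)
  \<comment> \<open>A single number has to certify all three memberships, so the three derivations
    are united.\<close>
  have "\<forall>i\<in>?U. justified ?U i"
    using A(2)[OF a] A(2)[OF b(1)] A(2)[OF c(1)] by (blast intro: justified_mono)
  then have "derivation (set_encode ?U)" unfolding derivation_def D .
  then have "catches (recf_encode r) N (pair a (pair b (pair c (set_encode ?U))))"
    using A(3)[OF a] A(3)[OF b(1)] A(3)[OF c(1)] b(2) c(2) by (simp add: catches_def D)
  then show ?thesis ..
qed

text \<open>Soundness turns the coded entries into true evaluations to 1, and determinism then rules
  out the value 0 of a non-member.\<close>

lemma catches_mem:
  assumes r: "\<And>x. rec_eval r [x] (if x \<in> H then 1 else 0)" and n: "catches (recf_encode r) N n"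
  shows "pfst n \<in> H" "pfst (psnd n) \<in> H" "pfst (psnd (psnd n)) \<in> H"
proof -
  let ?D = "set_decode (psnd (psnd (psnd n)))"
  have "x \<in> H" if "entry (recf_encode r) (cons x 0) 1 \<in> ?D" for x
  proof -
    have "rec_eval r [x] 1"
      by (rule justified_sound[of ?D]) (use n that in \<open>auto simp: catches_def derivation_def\<close>)
    from rec_eval_deterministic[OF this r[of x]] show ?thesis by (simp split: if_splits)
  qed
  with n show "pfst n \<in> H" "pfst (psnd n) \<in> H" "pfst (psnd (psnd n)) \<in> H"
    by (simp_all add: catches_def)
qed

lemma colour_not_constant:
  assumes "computable_set H" and H: "infinite H"
    and mono: "\<And>x y. x \<in> H \<Longrightarrow> y \<in> H \<Longrightarrow> x \<noteq> y \<Longrightarrow> colour (x + y) = k"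
  shows False
proof -
  from assms(1) obtain r where r: "\<And>x. rec_eval r [x] (if x \<in> H then 1 else 0)"
    unfolding computable_set_def computable_def by blast
  define e where "e = recf_encode r"
  obtain I t\<^sub>0 where I: "\<And>t. t \<ge> t\<^sub>0 \<Longrightarrow> interval t e = I" using interval_limit by blast
  have I_pos: "0 < psnd I" using interval_pos[of t\<^sub>0 e] I by simp
  from catches_exists[OF r H] obtain n where n: "catches e (psnd I) n"
    "\<And>t. n < t \<Longrightarrow> search t e I = n"
    unfolding e_def using search_eq by metis
  define a d d' where "a = pfst n" and "d = pfst (psnd n) - pfst n"
    and "d' = pfst (psnd (psnd n)) - pfst n"
  note gaps = catches_refine[OF n(1) I_pos, folded a_def d_def d'_def]
  have mem: "a \<in> H" "a + d \<in> H" "a + d' \<in> H"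
    using catches_mem[OF r n(1)[unfolded e_def]] gaps(3,4) by (simp_all add: a_def)
  let ?I = "refine 1 I d" and ?J = "refine 2 (refine 1 I d) d'"
  note I' = refine_subset[OF I_pos gaps(1), of 1]
  note J' = refine_subset[OF I'(3) gaps(2), of 2]
  have d_pos: "0 < d" "0 < d'" using gaps(1,2) I_pos I'(3) by simp_all
  \<comment> \<open>From \<open>s\<^sub>0\<close> on, the interval for \<open>e\<close> is final,
    the catch \<open>n\<close> has been found, and \<open>interval y y\<close> includes the action
    of requirement \<open>e\<close>.\<close>
  define s\<^sub>0 where "s\<^sub>0 = max t\<^sub>0 (max (Suc n) (Suc e))"
  have J: "lower ?J \<le> slope y" "slope y \<le> upper ?J" if "y \<ge> s\<^sub>0" for y
  proof -
    have y: "t\<^sub>0 \<le> y" "n < y" "Suc e \<le> y" using that unfolding s\<^sub>0_def by linarith+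
    have "interval y (Suc e) = ?J"
      using I[OF y(1)] n(2)[OF y(2)] y(2)
      by (simp add: interval_Suc shrink_def a_def d_def d'_def)
    with interval_nested[OF y(3), of y]
    have "lower ?J \<le> lower (interval y y)" "upper (interval y y) \<le> upper ?J" by simp_all
    moreover have "lower (interval y y) \<le> upper (interval y y)"
      unfolding lower_def upper_def by (intro divide_right_mono) simp_all
    ultimately show "lower ?J \<le> slope y" "slope y \<le> upper ?J"
      unfolding slope_def by linarith+
  qed
  \<comment> \<open>A large \<open>s\<close> serves two ends: all slopes from \<open>s + a\<close>
    on lie in \<open>?J\<close>, and \<open>s\<close> differs from the three elements of the triple,
    so that their sums with \<open>s\<close> are constrained by \<open>mono\<close>.\<close>
  obtain s where s: "s \<in> H" "s\<^sub>0 + a + d + d' < s"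
    using H infinite_nat_iff_unbounded by blast
  let ?X = "\<lambda>x. 2 * (\<Sum>y<x. slope y)"
  have s_ge: "s\<^sub>0 \<le> y" if "y \<ge> s + a" for y using that s(2) by linarith
  have J_s: "lower ?J \<le> slope y" "slope y \<le> upper ?J" if "s + a \<le> y" for y
    using J[OF s_ge[OF that]] .
  \<comment> \<open>Since \<open>?J\<close> lies inside \<open>?I\<close>, the second refinement
    preserves the control over the first difference.\<close>
  have I_s: "lower ?I \<le> slope y" "slope y \<le> upper ?I" if "s + a \<le> y" for y
    using J_s[OF that] J'(1,2) by linarith+
  obtain i :: int where i: "2 * i + 1/2 \<le> ?X (s + a + d) - ?X (s + a)"
    "?X (s + a + d) - ?X (s + a) \<le> 2 * i + 1"
    using refine_sum[OF d_pos(1) I_s] by auto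
  obtain j :: int where j: "2 * j + 1 \<le> ?X (s + a + d') - ?X (s + a)"
    "?X (s + a + d') - ?X (s + a) \<le> 2 * j + 3/2"
    using refine_sum[OF d_pos(2) J_s] by auto
  have "colour (s + (a + x)) = k" if "a + x \<in> H" "x \<le> d + d'" for x
    using mono[OF s(1) that(1)] that(2) s(2) by simp
  from this[of 0] this[of d] this[of d'] mem
  have "colour (s + a) = k" "colour (s + a + d) = k" "colour (s + a + d') = k"
    by (simp_all add: add.assoc)
  then have "even \<lfloor>?X (s + a)\<rfloor> \<longleftrightarrow> even \<lfloor>?X (s + a + d)\<rfloor>"
    "even \<lfloor>?X (s + a)\<rfloor> \<longleftrightarrow> even \<lfloor>?X (s + a + d')\<rfloor>"
    unfolding colour_eq[symmetric] by simp_all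
  from floor_parity[OF i j this] show False .
qed

theorem theorem3p1:
  "\<not> computably_true HT_eq2_2_instance HT_eq2_2_solution"
  unfolding not_computably_true_HT_eq2_2_iff
proof (intro exI[of _ colour] conjI notI allI)
  show "colour x \<in> {0, 1}" for x
    by (auto simp: colour_def)
  show "computable colour" by (rule computable_colour)
  show False if "\<exists>H. computable_set H \<and> infinite H \<and>
      (\<exists>k. \<forall>x\<in>H. \<forall>y\<in>H. x \<noteq> y \<longrightarrow> colour (x + y) = k)"
  proof -
    from that obtain H k where "computable_set H" "infinite H"
      "\<forall>x\<in>H. \<forall>y\<in>H. x \<noteq> y \<longrightarrow> colour (x + y) = k" by blast
    then show ?thesis by (intro colour_not_constant[of H k]) simp_all
  qed
qed

end
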